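(* Fix $\Delta t>0$ and $\Delta x>0$. For each $\varepsilon>0$ consider the first order and the second order fully discrete schemes for the two-discrete-velocity telegraph equation written out in the context. Assume that all discrete solutions are $\mathcal{O}(1)$ as $\varepsilon\to0$, i.e. all values $\sigma_i^{n},p_i^{n},q_i^{n},\rho_i^{n}$ entering the scheme are bounded by a constant independent of $\varepsilon$, $i$, $n$. Then both schemes are asymptotic preserving (AP), in the following sense. (1) First order scheme: as $\varepsilon\to0$, for every $i$ and $n\ge 0$, $$\frac{\sigma_i^{n+1}-\rho_i^n}{\Delta t}-\frac{\sigma_{i-1}^{n+1}-2\sigma_i^{n+1}+\sigma_{i+1}^{n+1}}{\Delta x^2}\to0,$$ and $$p_i^{n+1}-\sigma_i^{n+1}\to0,\qquad q_i^{n+1}-\sigma_i^{n+1}\to0,\qquad \rho_i^{n+1}-\sigma_i^{n+1}\to0.$$ That is, in the limit $p_i^{n+1}=q_i^{n+1}=\rho_i^{n+1}=\sigma_i^{n+1}$, where $\sigma^{n+1}$ solves $$\frac{\sigma_i^{n+1}-\rho_i^n}{\Delta t}-\frac{\sigma_{i-1}^{n+1}-2\sigma_i^{n+1}+\sigma_{i+1}^{n+1}}{\Delta x^2}=0,$$ which is a consistent discretization of the limiting heat equation $\rho_t-\rho_{xx}=0$. (2) Second order scheme: as $\varepsilon\to0$, for every $i$ and $n\ge1$, $$\frac{\rho_i^{n-1}-4\rho_i^n+3\sigma_i^{n+1}}{2\Delta t}-\frac{\sigma_{i-1}^{n+1}-2\sigma_i^{n+1}+\sigma_{i+1}^{n+1}}{\Delta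 x^2}\to0,$$ and $$p_i^{n+1}-\sigma_i^{n+1}\to0,\qquad q_i^{n+1}-\sigma_i^{n+1}\to0,\qquad \rho_i^{n+1}-\sigma_i^{n+1}\to0.$$ That is, in the limit $p_i^{n+1}=q_i^{n+1}=\rho_i^{n+1}=\sigma_i^{n+1}$, where $\sigma^{n+1}$ solves $$\frac{\rho_i^{n-1}-4\rho_i^n+3\sigma_i^{n+1}}{2\Delta t}-\frac{\sigma_{i-1}^{n+1}-2\sigma_i^{n+1}+\sigma_{i+1}^{n+1}}{\Delta x^2}=0,$$ which is a second order consistent discretization of $\rho_t-\rho_{xx}=0$.
   Context: The two-discrete-velocity telegraph equation is $f_t+\frac{v}{\varepsilon}f_x=\frac{1}{\varepsilon^2}(\rho-f)$ with $v\in\{-1,1\}$ and $\rho=\langle f\rangle=\frac12\big(f(x,1,t)+f(x,-1,t)\big)$. Its limit as $\varepsilon\to0$ is $f=\rho$, $\rho_t-\rho_{xx}=0$. Grid and notation: the mesh $x_i$ in space is uniform with size $\Delta x$ and periodic boundary conditions (indices are understood periodically), and the time step $\Delta t=t_{n+1}-t_n$ is uniform. The real numbers $p_i^n$, $q_i^n$, $\rho_i^n$ approximate $f(x_i,1,t_n)$, $f(x_i,-1,t_n)$, $\rho(x_i,t_n)$, and $\sigma_i^{n}$ denotes the approximation of $\rho(x_i,t_n)$ before the correction step. Put $\mu=1/\varepsilon^2$, let $m$ be the integer with $m<\frac{\Delta t}{\varepsilon\Delta x}\le m+1$, and let $\xi=\frac{\Delta t}{\varepsilon\Delta x}-m$.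 All discrete quantities, $m$ and $\xi$ depend on $\varepsilon$. First order scheme: $$\frac{\sigma_i^{n+1}-\rho_i^n}{\Delta t}+\frac{e^{-\mu\Delta t}}{2\varepsilon}\Big[\frac{p_{i-m-1}^n-p_{i-m-2}^n}{\Delta x}-\frac{\rho_{i-m+1}^n-\rho_{i-m}^n}{\Delta x}-\frac{q_{i+m+2}^n-q_{i+m+1}^n}{\Delta x}+\frac{\rho_{i+m}^n-\rho_{i+m-1}^n}{\Delta x}\Big]-(1-e^{-\mu\Delta t})\frac{\sigma_{i-1}^{n+1}-2\sigma_i^{n+1}+\sigma_{i+1}^{n+1}}{\Delta x^2}=0,$$ $$\frac{p_i^{n+1}-p_i^n}{\Delta t}+\frac{p_i^{n+1}-p_{i-1}^{n+1}}{\varepsilon\Delta x}=\frac{\sigma_i^{n+1}-p_i^{n+1}}{\varepsilon^2},\qquad \frac{q_i^{n+1}-q_i^n}{\Delta t}-\frac{q_{i+1}^{n+1}-q_i^{n+1}}{\varepsilon\Delta x}=\frac{\sigma_i^{n+1}-q_i^{n+1}}{\varepsilon^2},$$ $$\rho_i^{n+1}=\frac{p_i^{n+1}+q_i^{n+1}}{2}.$$ Second order scheme: $$\frac{\rho_i^{n-1}-4\rho_i^n+3\sigma_i^{n+1}}{2\Delta t}+\frac{e^{-\mu\Delta t}}{2\varepsilon}\Big[A_i^n-B_i^n-C_i^n+D_i^n\Big]-(1-e^{-\mu\Delta t})\frac{\sigma_{i-1}^{n+1}-2\sigma_i^{n+1}+\sigma_{i+1}^{n+1}}{\Delta x^2}=0,$$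 where $$A_i^n=\frac{1-2\xi}{2\Delta x}p_{i-m-2}^n-\frac{2-2\xi}{\Delta x}p_{i-m-1}^n+\frac{3-2\xi}{2\Delta x}p_{i-m}^n,$$ $$B_i^n=-\frac{1+2\xi}{2\Delta x}\rho_{i-m-1}^n+\frac{2\xi}{\Delta x}\rho_{i-m}^n+\frac{1-2\xi}{2\Delta x}\rho_{i-m+1}^n,$$ $$C_i^n=-\frac{3-2\xi}{2\Delta x}q_{i+m}^n+\frac{2-2\xi}{\Delta x}q_{i+m+1}^n-\frac{1-2\xi}{2\Delta x}q_{i+m+2}^n,$$ $$D_i^n=-\frac{1-2\xi}{2\Delta x}\rho_{i+m-1}^n-\frac{2\xi}{\Delta x}\rho_{i+m}^n+\frac{1+2\xi}{2\Delta x}\rho_{i+m+1}^n,$$ together with $$\frac{p_i^{n-1}-4p_i^n+3p_i^{n+1}}{2\Delta t}+\frac{p_{i-2}^{n+1}-4p_{i-1}^{n+1}+3p_i^{n+1}}{2\varepsilon\Delta x}=\frac{\sigma_i^{n+1}-p_i^{n+1}}{\varepsilon^2},$$ $$\frac{q_i^{n-1}-4q_i^n+3q_i^{n+1}}{2\Delta t}-\frac{-3q_i^{n+1}+4q_{i+1}^{n+1}-q_{i+2}^{n+1}}{2\varepsilon\Delta x}=\frac{\sigma_i^{n+1}-q_i^{n+1}}{\varepsilon^2},$$ $$\rho_i^{n+1}=\frac{p_i^{n+1}+q_i^{n+1}}{2}.$$ *)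

theory Defs
  imports "HOL-Analysis.Analysis"
begin

section \<open>The two discrete-velocity schemes\<close>

text \<open>
  A discrete quantity is a function of the time level \<open>n\<close> and of the space index \<open>i\<close>. Space indices
  are integers and the grid functions are periodic with period the number \<open>N\<close> of cells.
\<close>

type_synonym grid_function = "nat \<Rightarrow> int \<Rightarrow> real"

definition periodic_grid :: "nat \<Rightarrow> (int \<Rightarrow> real) \<Rightarrow> bool" where
  "periodic_grid N u \<longleftrightarrow> (\<forall>i. u (i + int N) = u i)"

definition is_shift :: "real \<Rightarrow> real \<Rightarrow> real \<Rightarrow> int \<Rightarrow> bool" where
  "is_shift dt dx \<epsilon> m \<longleftrightarrow>
     real_of_int m < dt / (\<epsilon> * dx) \<and> dt / (\<epsilon> * dx) \<le> real_of_int m + 1"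

definition lap :: "real \<Rightarrow> (int \<Rightarrow> real) \<Rightarrow> int \<Rightarrow> real" where
  "lap dx u i = (u (i - 1) - 2 * u i + u (i + 1)) / dx^2"

text \<open>
  In both schemes \<open>\<sigma> (n + 1)\<close> is computed from level \<open>n\<close>, so the values of \<open>\<sigma>\<close> that occur are
  those with level at least 1 (first order) and at least 2 (second order). The starting levels
  of \<open>p\<close>, \<open>q\<close>, \<open>\<rho>\<close> are arbitrary; in particular \<open>\<rho> = (p + q) / 2\<close> is not required of them.
\<close>

definition first_order_scheme ::
  "real \<Rightarrow> real \<Rightarrow> nat \<Rightarrow> real \<Rightarrow> int \<Rightarrow>
   grid_function \<Rightarrow> grid_function \<Rightarrow> grid_function \<Rightarrow> grid_function \<Rightarrow> bool" where
  "first_order_scheme dt dx N \<epsilon> m \<sigma> p q \<rho> \<longleftrightarrow>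
     (let \<mu> = 1 / \<epsilon>^2 in
      (\<forall>n. periodic_grid N (\<sigma> (n + 1)) \<and> periodic_grid N (p n) \<and>
           periodic_grid N (q n) \<and> periodic_grid N (\<rho> n)) \<and>
      (\<forall>n i.
        (\<sigma> (n + 1) i - \<rho> n i) / dt
          + exp (- \<mu> * dt) / (2 * \<epsilon>) *
              ((p n (i - m - 1) - p n (i - m - 2)) / dx
               - (\<rho> n (i - m + 1) - \<rho> n (i - m)) / dx
               - (q n (i + m + 2) - q n (i + m + 1)) / dx
               + (\<rho> n (i + m) - \<rho> n (i + m - 1)) / dx)
          - (1 - exp (- \<mu> * dt)) * lap dx (\<sigma> (n + 1)) i = 0 \<and>
        (p (n + 1) i - p n i) / dt + (p (n + 1) i - p (n + 1) (i - 1)) / (\<epsilon> * dx)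
          = (\<sigma> (n + 1) i - p (n + 1) i) / \<epsilon>^2 \<and>
        (q (n + 1) i - q n i) / dt - (q (n + 1) (i + 1) - q (n + 1) i) / (\<epsilon> * dx)
          = (\<sigma> (n + 1) i - q (n + 1) i) / \<epsilon>^2 \<and>
        \<rho> (n + 1) i = (p (n + 1) i + q (n + 1) i) / 2))"

definition flux_A :: "real \<Rightarrow> int \<Rightarrow> real \<Rightarrow> (int \<Rightarrow> real) \<Rightarrow> int \<Rightarrow> real" where
  "flux_A dx m \<xi> p i =
     (1 - 2 * \<xi>) / (2 * dx) * p (i - m - 2) - (2 - 2 * \<xi>) / dx * p (i - m - 1)
     + (3 - 2 * \<xi>) / (2 * dx) * p (i - m)"

definition flux_B :: "real \<Rightarrow> int \<Rightarrow> real \<Rightarrow> (int \<Rightarrow> real) \<Rightarrow> int \<Rightarrow> real" where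
  "flux_B dx m \<xi> \<rho> i =
     - ((1 + 2 * \<xi>) / (2 * dx)) * \<rho> (i - m - 1) + 2 * \<xi> / dx * \<rho> (i - m)
     + (1 - 2 * \<xi>) / (2 * dx) * \<rho> (i - m + 1)"

definition flux_C :: "real \<Rightarrow> int \<Rightarrow> real \<Rightarrow> (int \<Rightarrow> real) \<Rightarrow> int \<Rightarrow> real" where
  "flux_C dx m \<xi> q i =
     - ((3 - 2 * \<xi>) / (2 * dx)) * q (i + m) + (2 - 2 * \<xi>) / dx * q (i + m + 1)
     - (1 - 2 * \<xi>) / (2 * dx) * q (i + m + 2)"

definition flux_D :: "real \<Rightarrow> int \<Rightarrow> real \<Rightarrow> (int \<Rightarrow> real) \<Rightarrow> int \<Rightarrow> real" where
  "flux_D dx m \<xi> \<rho> i =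
     - ((1 - 2 * \<xi>) / (2 * dx)) * \<rho> (i + m - 1) - 2 * \<xi> / dx * \<rho> (i + m)
     + (1 + 2 * \<xi>) / (2 * dx) * \<rho> (i + m + 1)"

definition second_order_scheme ::
  "real \<Rightarrow> real \<Rightarrow> nat \<Rightarrow> real \<Rightarrow> int \<Rightarrow>
   grid_function \<Rightarrow> grid_function \<Rightarrow> grid_function \<Rightarrow> grid_function \<Rightarrow> bool" where
  "second_order_scheme dt dx N \<epsilon> m \<sigma> p q \<rho> \<longleftrightarrow>
     (let \<mu> = 1 / \<epsilon>^2; \<xi> = dt / (\<epsilon> * dx) - real_of_int m in
      (\<forall>n\<ge>1. periodic_grid N (\<sigma> (n + 1))) \<and>
      (\<forall>n. periodic_grid N (p n) \<and> periodic_grid N (q n) \<and> periodic_grid N (\<rho> n)) \<and>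
      (\<forall>n\<ge>1. \<forall>i.
        (\<rho> (n - 1) i - 4 * \<rho> n i + 3 * \<sigma> (n + 1) i) / (2 * dt)
          + exp (- \<mu> * dt) / (2 * \<epsilon>) *
              (flux_A dx m \<xi> (p n) i - flux_B dx m \<xi> (\<rho> n) i
               - flux_C dx m \<xi> (q n) i + flux_D dx m \<xi> (\<rho> n) i)
          - (1 - exp (- \<mu> * dt)) * lap dx (\<sigma> (n + 1)) i = 0 \<and>
        (p (n - 1) i - 4 * p n i + 3 * p (n + 1) i) / (2 * dt)
          + (p (n + 1) (i - 2) - 4 * p (n + 1) (i - 1) + 3 * p (n + 1) i) / (2 * \<epsilon> * dx)
          = (\<sigma> (n + 1) i - p (n + 1) i) / \<epsilon>^2 \<and>
        (q (n - 1) i - 4 * q n i + 3 * q (n + 1) i) / (2 * dt)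
          - (- 3 * q (n + 1) i + 4 * q (n + 1) (i + 1) - q (n + 1) (i + 2)) / (2 * \<epsilon> * dx)
          = (\<sigma> (n + 1) i - q (n + 1) i) / \<epsilon>^2 \<and>
        \<rho> (n + 1) i = (p (n + 1) i + q (n + 1) i) / 2))"

text \<open>
  \<open>O(1)\<close> as \<open>\<epsilon>\<close> tends to 0: one bound for all small \<open>\<epsilon>\<close>, all space indices and all time
  levels. The number \<open>k\<close> is the first level at which \<open>\<sigma>\<close> occurs in the scheme.
\<close>

definition bounded_solutions ::
  "nat \<Rightarrow> (real \<Rightarrow> grid_function) \<Rightarrow> (real \<Rightarrow> grid_function) \<Rightarrow>
   (real \<Rightarrow> grid_function) \<Rightarrow> (real \<Rightarrow> grid_function) \<Rightarrow> bool" where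
  "bounded_solutions k \<sigma> p q \<rho> \<longleftrightarrow>
     (\<exists>C. \<forall>\<^sub>F \<epsilon> in at_right 0. \<forall>n i.
        (n \<ge> k \<longrightarrow> \<bar>\<sigma> \<epsilon> n i\<bar> \<le> C) \<and>
        \<bar>p \<epsilon> n i\<bar> \<le> C \<and> \<bar>q \<epsilon> n i\<bar> \<le> C \<and> \<bar>\<rho> \<epsilon> n i\<bar> \<le> C)"

section \<open>The limiting schemes and their consistency with the heat equation\<close>

definition heat_euler :: "real \<Rightarrow> real \<Rightarrow> (int \<Rightarrow> real) \<Rightarrow> (int \<Rightarrow> real) \<Rightarrow> int \<Rightarrow> real" where
  "heat_euler dt dx r s i = (s i - r i) / dt - lap dx s i"

definition heat_bdf2 ::
  "real \<Rightarrow> real \<Rightarrow> (int \<Rightarrow> real) \<Rightarrow> (int \<Rightarrow> real) \<Rightarrow> (int \<Rightarrow> real) \<Rightarrow> int \<Rightarrow> real" where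
  "heat_bdf2 dt dx r' r s i = (r' i - 4 * r i + 3 * s i) / (2 * dt) - lap dx s i"

text \<open>
  \<open>C\<^sup>k\<close> functions of \<open>(x, t)\<close> on the plane. In the step the continuity of \<open>\<phi>\<close> itself follows
  from that of its partial derivatives.
\<close>

fun C_k :: "nat \<Rightarrow> (real \<Rightarrow> real \<Rightarrow> real) \<Rightarrow> bool" where
  "C_k 0 \<phi> \<longleftrightarrow> continuous_on UNIV (\<lambda>(x, t). \<phi> x t)"
| "C_k (Suc k) \<phi> \<longleftrightarrow> (\<exists>\<phi>x \<phi>t. C_k k \<phi>x \<and> C_k k \<phi>t \<and>
     (\<forall>x t. ((\<lambda>y. \<phi> y t) has_real_derivative \<phi>x x t) (at x) \<and>
            ((\<lambda>s. \<phi> x s) has_real_derivative \<phi>t x t) (at t)))"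

definition smooth_fun :: "(real \<Rightarrow> real \<Rightarrow> real) \<Rightarrow> bool" where
  "smooth_fun \<phi> \<longleftrightarrow> (\<forall>k. C_k k \<phi>)"

definition heat_op :: "(real \<Rightarrow> real \<Rightarrow> real) \<Rightarrow> real \<Rightarrow> real \<Rightarrow> real" where
  "heat_op \<phi> x t = deriv (\<lambda>s. \<phi> x s) t - deriv (deriv (\<lambda>y. \<phi> y t)) x"

text \<open>
  Values of \<open>\<phi>\<close> on the grid through \<open>(x, t)\<close>; the first index is the time level relative to
  \<open>t\<close>, the second one the space index relative to \<open>x\<close>.
\<close>

definition sample ::
  "(real \<Rightarrow> real \<Rightarrow> real) \<Rightarrow> real \<Rightarrow> real \<Rightarrow> real \<Rightarrow> real \<Rightarrow> int \<Rightarrow> int \<Rightarrow> real" where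
  "sample \<phi> x t dt dx j i = \<phi> (x + of_int i * dx) (t + of_int j * dt)"

text \<open>
  Consistency of a difference operator \<open>L\<close> with \<open>\<phi>\<^sub>t - \<phi>\<^sub>x\<^sub>x\<close> in the usual sense: for smooth test
  functions the difference tends to 0 with the mesh sizes, without any restriction on their
  ratio and uniformly on bounded sets. On solutions of the heat equation \<open>heat_op\<close>
  vanishes, so that the difference is the truncation error of the scheme \<open>L u = 0\<close>.
\<close>

definition heat_consistent :: "(real \<Rightarrow> real \<Rightarrow> (int \<Rightarrow> int \<Rightarrow> real) \<Rightarrow> real) \<Rightarrow> bool" where
  "heat_consistent L \<longleftrightarrow>
     (\<forall>\<phi> R. smooth_fun \<phi> \<longrightarrow>
        (\<forall>\<eta>>0. \<exists>\<delta>>0. \<forall>dt\<in>{0<..<\<delta>}. \<forall>dx\<in>{0<..<\<delta>}. \<forall>x\<in>{-R..R}. \<forall>t\<in>{-R..R}.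
           \<bar>L dt dx (sample \<phi> x t dt dx) - heat_op \<phi> x t\<bar> < \<eta>))"

definition heat_consistent_order ::
  "nat \<Rightarrow> (real \<Rightarrow> real \<Rightarrow> (int \<Rightarrow> int \<Rightarrow> real) \<Rightarrow> real) \<Rightarrow> bool" where
  "heat_consistent_order k L \<longleftrightarrow>
     (\<forall>\<phi> R. smooth_fun \<phi> \<longrightarrow>
        (\<exists>C. \<exists>\<delta>>0. \<forall>dt\<in>{0<..<\<delta>}. \<forall>dx\<in>{0<..<\<delta>}. \<forall>x\<in>{-R..R}. \<forall>t\<in>{-R..R}.
           \<bar>L dt dx (sample \<phi> x t dt dx) - heat_op \<phi> x t\<bar> \<le> C * (dt ^ k + dx ^ k)))"

end

theory Submission
  imports Defs "HOL-Real_Asymp.Real_Asymp"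
begin

text \<open>
  The step size \<open>dt\<close> and the mesh width \<open>dx\<close> stay fixed while \<open>\<epsilon>\<close> tends to 0, so every difference
  quotient of a bounded grid function is bounded uniformly in \<open>\<epsilon>\<close>. What depends on \<open>\<epsilon>\<close> is only
  the scaling in front of these quotients, and it acts in two ways.

  In the equations for \<open>p\<close> and \<open>q\<close> the relaxation term carries \<open>1 / \<epsilon>\<^sup>2\<close>, the transport term
  \<open>1 / \<epsilon>\<close> and the time difference no power of \<open>\<epsilon>\<close> at all. Multiplying by \<open>\<epsilon>\<^sup>2\<close> leaves
  \<open>p - \<sigma> = O(\<epsilon>)\<close> and \<open>q - \<sigma> = O(\<epsilon>)\<close> (\<open>relaxation_limit\<close>), and their mean \<open>\<rho>\<close> inherits this.
  In the equation for \<open>\<sigma>\<close> the flux terms carry \<open>exp (- dt / \<epsilon>\<^sup>2) / \<epsilon>\<close> and the Laplacian carries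
  \<open>1 - exp (- dt / \<epsilon>\<^sup>2)\<close>; the exponential beats every power of \<open>\<epsilon>\<close>, so that only the
  implicit heat scheme survives (\<open>diffusive_limit\<close>). The shift \<open>m\<close> grows without bound as
  \<open>\<epsilon>\<close> tends to 0, but it enters only through the points at which bounded functions are evaluated,
  and \<open>\<xi>\<close>, which enters through the weights of the second order fluxes, stays in the unit interval.

  The limiting operators are backward Euler and the two-step backward differentiation formula
  in time, combined with the three-point Laplacian. Their truncation errors are Taylor remainders,
  controlled by the maximum of one pure partial derivative on a compact square that contains
  all stencils: of \<open>\<phi>\<^sub>t\<^sub>t\<close> or \<open>\<phi>\<^sub>t\<^sub>t\<^sub>t\<close> in time and of \<open>\<phi>\<^sub>x\<^sub>x\<^sub>x\<^sub>x\<close> in space. Time and space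
  contributions are estimated separately, whatever the ratio of \<open>dt\<close> to \<open>dx\<close>.
\<close>

section \<open>Vanishing terms of the schemes\<close>

lemma abs_divide_le:
  fixes u d B :: real
  assumes "\<bar>u\<bar> \<le> B" and "d > 0"
  shows "\<bar>u / d\<bar> \<le> B / d"
  using assms by (simp add: abs_divide divide_right_mono)

lemma lap_bound:
  assumes "\<And>i. \<bar>u i\<bar> \<le> C" and "dx > 0"
  shows "\<bar>lap dx u i\<bar> \<le> 4 * C / dx^2"
proof -
  have "\<bar>u (i - 1) - 2 * u i + u (i + 1)\<bar> \<le> 4 * C"
    using assms(1)[of "i - 1"] assms(1)[of i] assms(1)[of "i + 1"] by linarith
  then show ?thesis
    unfolding lap_def using assms(2) by (intro abs_divide_le) auto
qed

text \<open>
  Here \<open>S\<close> stands for the time difference and \<open>T / \<epsilon>\<close> for the transport term of a kinetic equation.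
  The equation itself, multiplied by \<open>\<epsilon>\<^sup>2\<close>, expresses \<open>f - s\<close> through bounded terms with the factors
  \<open>\<epsilon>\<^sup>2\<close> and \<open>\<epsilon>\<close>.
\<close>

lemma relaxation_limit:
  fixes f s S T :: "real \<Rightarrow> real"
  assumes eq: "\<And>\<epsilon>. \<epsilon> > 0 \<Longrightarrow> S \<epsilon> + T \<epsilon> / \<epsilon> = (s \<epsilon> - f \<epsilon>) / \<epsilon>^2"
    and S: "\<forall>\<^sub>F \<epsilon> in at_right 0. \<bar>S \<epsilon>\<bar> \<le> K"
    and T: "\<forall>\<^sub>F \<epsilon> in at_right 0. \<bar>T \<epsilon>\<bar> \<le> L"
  shows "((\<lambda>\<epsilon>. f \<epsilon> - s \<epsilon>) \<longlongrightarrow> 0) (at_right 0)"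
proof (rule Lim_null_comparison)
  show "((\<lambda>\<epsilon>. \<epsilon>^2 * K + \<epsilon> * L) \<longlongrightarrow> 0) (at_right 0)"
    by (auto intro!: tendsto_eq_intros)
  show "\<forall>\<^sub>F \<epsilon> in at_right 0. norm (f \<epsilon> - s \<epsilon>) \<le> \<epsilon>^2 * K + \<epsilon> * L"
    using S T eventually_at_right_less[of 0]
  proof eventually_elim
    case (elim \<epsilon>)
    have "\<epsilon>^2 * S \<epsilon> + \<epsilon> * T \<epsilon> = \<epsilon>^2 * (S \<epsilon> + T \<epsilon> / \<epsilon>)"
      using elim(3) by (simp add: distrib_left power2_eq_square)
    also have "\<dots> = s \<epsilon> - f \<epsilon>"
      using eq[OF elim(3)] elim(3) by simp
    finally have "f \<epsilon> - s \<epsilon> = - (\<epsilon>^2 * S \<epsilon> + \<epsilon> * T \<epsilon>)"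
      by simp
    also have "\<bar>\<dots>\<bar> \<le> \<epsilon>^2 * \<bar>S \<epsilon>\<bar> + \<epsilon> * \<bar>T \<epsilon>\<bar>"
      using elim(3) abs_triangle_ineq[of "\<epsilon>^2 * S \<epsilon>" "\<epsilon> * T \<epsilon>"]
      unfolding abs_minus_cancel by (simp add: abs_mult)
    also have "\<dots> \<le> \<epsilon>^2 * K + \<epsilon> * L"
      using elim by (intro add_mono mult_left_mono) auto
    finally show ?case by simp
  qed
qed

lemma exp_flux_limit:
  fixes dt :: real
  assumes "dt > 0"
  shows "((\<lambda>\<epsilon>. exp (- (1 / \<epsilon>^2) * dt) / (2 * \<epsilon>)) \<longlongrightarrow> 0) (at_right 0)"
    and "((\<lambda>\<epsilon>. exp (- (1 / \<epsilon>^2) * dt)) \<longlongrightarrow> 0) (at_right 0)"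
  using assms by real_asymp+

text \<open>
  The prediction step has this form in both schemes: \<open>E\<close> is the time difference, \<open>F\<close> the bracket of
  upwind fluxes and \<open>L\<close> the discrete Laplacian. Solved for \<open>E - L\<close>, it contains only terms with
  exponentially small coefficients.
\<close>

lemma diffusive_limit:
  fixes E F L :: "real \<Rightarrow> real"
  assumes dt: "dt > 0"
    and eq: "\<And>\<epsilon>. \<epsilon> > 0 \<Longrightarrow> E \<epsilon> + exp (- (1 / \<epsilon>^2) * dt) / (2 * \<epsilon>) * F \<epsilon>
               - (1 - exp (- (1 / \<epsilon>^2) * dt)) * L \<epsilon> = 0"
    and F: "\<forall>\<^sub>F \<epsilon> in at_right 0. \<bar>F \<epsilon>\<bar> \<le> K"
    and L: "\<forall>\<^sub>F \<epsilon> in at_right 0. \<bar>L \<epsilon>\<bar> \<le> M"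
  shows "((\<lambda>\<epsilon>. E \<epsilon> - L \<epsilon>) \<longlongrightarrow> 0) (at_right 0)"
proof (rule Lim_null_comparison)
  let ?a = "\<lambda>\<epsilon>::real. exp (- (1 / \<epsilon>^2) * dt) / (2 * \<epsilon>)"
  let ?b = "\<lambda>\<epsilon>::real. exp (- (1 / \<epsilon>^2) * dt)"
  show "((\<lambda>\<epsilon>. ?a \<epsilon> * K + ?b \<epsilon> * M) \<longlongrightarrow> 0) (at_right 0)"
    using exp_flux_limit[OF dt]
    by (intro tendsto_add_zero tendsto_mult_left_zero)
  show "\<forall>\<^sub>F \<epsilon> in at_right 0. norm (E \<epsilon> - L \<epsilon>) \<le> ?a \<epsilon> * K + ?b \<epsilon> * M"
    using F L eventually_at_right_less[of 0]
  proof eventually_elim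
    case (elim \<epsilon>)
    have a: "?a \<epsilon> \<ge> 0" using elim(3) by simp
    have "E \<epsilon> - L \<epsilon> = - (?a \<epsilon> * F \<epsilon> + ?b \<epsilon> * L \<epsilon>)"
      using eq[OF elim(3)] by (simp add: left_diff_distrib)
    also have "\<bar>\<dots>\<bar> \<le> ?a \<epsilon> * \<bar>F \<epsilon>\<bar> + ?b \<epsilon> * \<bar>L \<epsilon>\<bar>"
      using a abs_triangle_ineq[of "?a \<epsilon> * F \<epsilon>" "?b \<epsilon> * L \<epsilon>"] elim(3)
      unfolding abs_minus_cancel by (simp add: abs_mult)
    also have "\<dots> \<le> ?a \<epsilon> * K + ?b \<epsilon> * M"
      using elim a by (intro add_mono mult_left_mono) auto
    finally show ?case by simp
  qed
qed

text \<open>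
  The absolute weights of each second order flux, over the common denominator \<open>2 * dx\<close>, add up
  to at most 8 for all \<open>\<xi>\<close> in the unit interval.
\<close>

lemma three_point_bound:
  fixes a b c u v w C d :: real
  assumes "\<bar>a\<bar> + \<bar>b\<bar> + \<bar>c\<bar> \<le> 8" and "\<bar>u\<bar> \<le> C" "\<bar>v\<bar> \<le> C" "\<bar>w\<bar> \<le> C" and "d > 0"
  shows "\<bar>(a * u + b * v + c * w) / (2 * d)\<bar> \<le> 4 * C / d"
proof -
  have "\<bar>a * u + b * v + c * w\<bar> \<le> \<bar>a\<bar> * \<bar>u\<bar> + \<bar>b\<bar> * \<bar>v\<bar> + \<bar>c\<bar> * \<bar>w\<bar>"
    unfolding abs_mult[symmetric] by linarith
  also have "\<dots> \<le> \<bar>a\<bar> * C + \<bar>b\<bar> * C + \<bar>c\<bar> * C"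
    using assms by (intro add_mono mult_left_mono) auto
  also have "\<dots> = (\<bar>a\<bar> + \<bar>b\<bar> + \<bar>c\<bar>) * C"
    by (simp add: algebra_simps)
  also have "\<dots> \<le> 8 * C"
    using assms by (intro mult_right_mono) auto
  finally have "\<bar>(a * u + b * v + c * w) / (2 * d)\<bar> \<le> (8 * C) / (2 * d)"
    using assms(5) by (intro abs_divide_le) auto
  then show ?thesis by simp
qed

text \<open>
  The bounds depend neither on \<open>m\<close> nor on \<open>\<xi>\<close>, hence not on \<open>\<epsilon>\<close>.
\<close>

lemma flux_bounds:
  assumes xi: "0 \<le> \<xi>" "\<xi> \<le> 1" and dx: "dx > 0" and u: "\<And>i. \<bar>u i\<bar> \<le> C"
  shows "\<bar>flux_A dx m \<xi> u i\<bar> \<le> 4 * C / dx" "\<bar>flux_B dx m \<xi> u i\<bar> \<le> 4 * C / dx"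
    and "\<bar>flux_C dx m \<xi> u i\<bar> \<le> 4 * C / dx" "\<bar>flux_D dx m \<xi> u i\<bar> \<le> 4 * C / dx"
proof -
  note bnd = three_point_bound[OF _ u u u dx]
  have A: "flux_A dx m \<xi> u i = ((1 - 2 * \<xi>) * u (i - m - 2) + (4 * \<xi> - 4) * u (i - m - 1)
      + (3 - 2 * \<xi>) * u (i - m)) / (2 * dx)"
    unfolding flux_A_def using dx by (simp add: field_simps)
  show "\<bar>flux_A dx m \<xi> u i\<bar> \<le> 4 * C / dx"
    unfolding A by (rule bnd) (use xi in \<open>auto simp: abs_if\<close>)
  have B: "flux_B dx m \<xi> u i = ((- 1 - 2 * \<xi>) * u (i - m - 1) + (4 * \<xi>) * u (i - m)
      + (1 - 2 * \<xi>) * u (i - m + 1)) / (2 * dx)"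
    unfolding flux_B_def using dx by (simp add: field_simps)
  show "\<bar>flux_B dx m \<xi> u i\<bar> \<le> 4 * C / dx"
    unfolding B by (rule bnd) (use xi in \<open>auto simp: abs_if\<close>)
  have C: "flux_C dx m \<xi> u i = ((2 * \<xi> - 3) * u (i + m) + (4 - 4 * \<xi>) * u (i + m + 1)
      + (2 * \<xi> - 1) * u (i + m + 2)) / (2 * dx)"
    unfolding flux_C_def using dx by (simp add: field_simps)
  show "\<bar>flux_C dx m \<xi> u i\<bar> \<le> 4 * C / dx"
    unfolding C by (rule bnd) (use xi in \<open>auto simp: abs_if\<close>)
  have D: "flux_D dx m \<xi> u i = ((2 * \<xi> - 1) * u (i + m - 1) + (- 4 * \<xi>) * u (i + m)
      + (1 + 2 * \<xi>) * u (i + m + 1)) / (2 * dx)"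
    unfolding flux_D_def using dx by (simp add: field_simps)
  show "\<bar>flux_D dx m \<xi> u i\<bar> \<le> 4 * C / dx"
    unfolding D by (rule bnd) (use xi in \<open>auto simp: abs_if\<close>)
qed

section \<open>Asymptotic preservation\<close>

lemma first_order_ap:
  assumes dt: "dt > 0" and dx: "dx > 0"
    and scheme: "\<And>\<epsilon>. \<epsilon> > 0 \<Longrightarrow>
      first_order_scheme dt dx N \<epsilon> (m \<epsilon>) (\<sigma> \<epsilon>) (p \<epsilon>) (q \<epsilon>) (\<rho> \<epsilon>)"
    and bounded: "bounded_solutions 1 \<sigma> p q \<rho>"
  shows "((\<lambda>\<epsilon>. heat_euler dt dx (\<rho> \<epsilon> n) (\<sigma> \<epsilon> (n + 1)) i) \<longlongrightarrow> 0) (at_right 0)"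
    and "((\<lambda>\<epsilon>. p \<epsilon> (n + 1) i - \<sigma> \<epsilon> (n + 1) i) \<longlongrightarrow> 0) (at_right 0)"
    and "((\<lambda>\<epsilon>. q \<epsilon> (n + 1) i - \<sigma> \<epsilon> (n + 1) i) \<longlongrightarrow> 0) (at_right 0)"
proof -
  obtain C where C: "\<forall>\<^sub>F \<epsilon> in at_right 0. \<forall>n i. (n \<ge> 1 \<longrightarrow> \<bar>\<sigma> \<epsilon> n i\<bar> \<le> C) \<and>
        \<bar>p \<epsilon> n i\<bar> \<le> C \<and> \<bar>q \<epsilon> n i\<bar> \<le> C \<and> \<bar>\<rho> \<epsilon> n i\<bar> \<le> C"
    using bounded unfolding bounded_solutions_def by blast
  note step = scheme[unfolded first_order_scheme_def Let_def, THEN conjunct2, rule_format,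
      of _ n i]
  have diff: "\<bar>x - y\<bar> \<le> 2 * C" if "\<bar>x\<bar> \<le> C" "\<bar>y\<bar> \<le> C" for x y :: real
    using that by linarith
  let ?F = "\<lambda>\<epsilon>. (p \<epsilon> n (i - m \<epsilon> - 1) - p \<epsilon> n (i - m \<epsilon> - 2)) / dx
               - (\<rho> \<epsilon> n (i - m \<epsilon> + 1) - \<rho> \<epsilon> n (i - m \<epsilon>)) / dx
               - (q \<epsilon> n (i + m \<epsilon> + 2) - q \<epsilon> n (i + m \<epsilon> + 1)) / dx
               + (\<rho> \<epsilon> n (i + m \<epsilon>) - \<rho> \<epsilon> n (i + m \<epsilon> - 1)) / dx"
  show "((\<lambda>\<epsilon>. heat_euler dt dx (\<rho> \<epsilon> n) (\<sigma> \<epsilon> (n + 1)) i) \<longlongrightarrow> 0) (at_right 0)"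
    unfolding heat_euler_def
  proof (rule diffusive_limit[OF dt, where F = ?F])
    show "\<forall>\<^sub>F \<epsilon> in at_right 0. \<bar>?F \<epsilon>\<bar> \<le> 4 * (2 * C / dx)"
      using C
    proof eventually_elim
      case (elim \<epsilon>)
      have d: "\<bar>(x - y) / dx\<bar> \<le> 2 * C / dx" if "\<bar>x\<bar> \<le> C" "\<bar>y\<bar> \<le> C" for x y :: real
        using diff[OF that] dx by (rule abs_divide_le)
      have four: "\<bar>a - b - c + e\<bar> \<le> 4 * B"
        if "\<bar>a\<bar> \<le> B" "\<bar>b\<bar> \<le> B" "\<bar>c\<bar> \<le> B" "\<bar>e\<bar> \<le> B" for a b c e B :: real
        using that by linarith
      show ?case
        by (intro four d) (use elim in blast)+
    qed
    show "\<forall>\<^sub>F \<epsilon> in at_right 0. \<bar>lap dx (\<sigma> \<epsilon> (n + 1)) i\<bar> \<le> 4 * C / dx^2"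
      using C by eventually_elim (rule lap_bound[OF _ dx], simp)
  qed (use step in blast)
  show "((\<lambda>\<epsilon>. p \<epsilon> (n + 1) i - \<sigma> \<epsilon> (n + 1) i) \<longlongrightarrow> 0) (at_right 0)"
  proof (rule relaxation_limit)
    show "(p \<epsilon> (n + 1) i - p \<epsilon> n i) / dt + (p \<epsilon> (n + 1) i - p \<epsilon> (n + 1) (i - 1)) / dx / \<epsilon>
        = (\<sigma> \<epsilon> (n + 1) i - p \<epsilon> (n + 1) i) / \<epsilon>^2" if "\<epsilon> > 0" for \<epsilon>
      using step[OF that] by (simp add: mult.commute)
    show "\<forall>\<^sub>F \<epsilon> in at_right 0. \<bar>(p \<epsilon> (n + 1) i - p \<epsilon> n i) / dt\<bar> \<le> 2 * C / dt"
      using C by eventually_elim (intro abs_divide_le diff dt, blast+)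
    show "\<forall>\<^sub>F \<epsilon> in at_right 0. \<bar>(p \<epsilon> (n + 1) i - p \<epsilon> (n + 1) (i - 1)) / dx\<bar> \<le> 2 * C / dx"
      using C by eventually_elim (intro abs_divide_le diff dx, blast+)
  qed
  show "((\<lambda>\<epsilon>. q \<epsilon> (n + 1) i - \<sigma> \<epsilon> (n + 1) i) \<longlongrightarrow> 0) (at_right 0)"
  proof (rule relaxation_limit)
    show "(q \<epsilon> (n + 1) i - q \<epsilon> n i) / dt + (q \<epsilon> (n + 1) i - q \<epsilon> (n + 1) (i + 1)) / dx / \<epsilon>
        = (\<sigma> \<epsilon> (n + 1) i - q \<epsilon> (n + 1) i) / \<epsilon>^2" if "\<epsilon> > 0" for \<epsilon>
      using step[OF that] by (simp add: mult.commute diff_divide_distrib)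
    show "\<forall>\<^sub>F \<epsilon> in at_right 0. \<bar>(q \<epsilon> (n + 1) i - q \<epsilon> n i) / dt\<bar> \<le> 2 * C / dt"
      using C by eventually_elim (intro abs_divide_le diff dt, blast+)
    show "\<forall>\<^sub>F \<epsilon> in at_right 0. \<bar>(q \<epsilon> (n + 1) i - q \<epsilon> (n + 1) (i + 1)) / dx\<bar> \<le> 2 * C / dx"
      using C by eventually_elim (intro abs_divide_le diff dx, blast+)
  qed
qed

text \<open>
  The bounds that define the shift confine \<open>\<xi>\<close> to the unit interval; this keeps the flux weights
  bounded as \<open>\<epsilon>\<close> tends to 0.
\<close>

lemma second_order_ap:
  assumes dt: "dt > 0" and dx: "dx > 0"
    and shift: "\<And>\<epsilon>. \<epsilon> > 0 \<Longrightarrow> is_shift dt dx \<epsilon> (m \<epsilon>)"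
    and scheme: "\<And>\<epsilon>. \<epsilon> > 0 \<Longrightarrow>
      second_order_scheme dt dx N \<epsilon> (m \<epsilon>) (\<sigma> \<epsilon>) (p \<epsilon>) (q \<epsilon>) (\<rho> \<epsilon>)"
    and bounded: "bounded_solutions 2 \<sigma> p q \<rho>"
    and n: "n \<ge> 1"
  shows "((\<lambda>\<epsilon>. heat_bdf2 dt dx (\<rho> \<epsilon> (n - 1)) (\<rho> \<epsilon> n) (\<sigma> \<epsilon> (n + 1)) i) \<longlongrightarrow> 0) (at_right 0)"
    and "((\<lambda>\<epsilon>. p \<epsilon> (n + 1) i - \<sigma> \<epsilon> (n + 1) i) \<longlongrightarrow> 0) (at_right 0)"
    and "((\<lambda>\<epsilon>. q \<epsilon> (n + 1) i - \<sigma> \<epsilon> (n + 1) i) \<longlongrightarrow> 0) (at_right 0)"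
proof -
  obtain C where C: "\<forall>\<^sub>F \<epsilon> in at_right 0. \<forall>n i. (n \<ge> 2 \<longrightarrow> \<bar>\<sigma> \<epsilon> n i\<bar> \<le> C) \<and>
        \<bar>p \<epsilon> n i\<bar> \<le> C \<and> \<bar>q \<epsilon> n i\<bar> \<le> C \<and> \<bar>\<rho> \<epsilon> n i\<bar> \<le> C"
    using bounded unfolding bounded_solutions_def by blast
  note step = scheme[unfolded second_order_scheme_def Let_def, THEN conjunct2, THEN conjunct2,
      rule_format, OF _ n, of _ i]
  have bdf: "\<bar>x - 4 * y + 3 * z\<bar> \<le> 8 * C" if "\<bar>x\<bar> \<le> C" "\<bar>y\<bar> \<le> C" "\<bar>z\<bar> \<le> C" for x y z :: real
    using that by linarith
  let ?\<xi> = "\<lambda>\<epsilon>. dt / (\<epsilon> * dx) - real_of_int (m \<epsilon>)"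
  let ?F = "\<lambda>\<epsilon>. flux_A dx (m \<epsilon>) (?\<xi> \<epsilon>) (p \<epsilon> n) i - flux_B dx (m \<epsilon>) (?\<xi> \<epsilon>) (\<rho> \<epsilon> n) i
               - flux_C dx (m \<epsilon>) (?\<xi> \<epsilon>) (q \<epsilon> n) i + flux_D dx (m \<epsilon>) (?\<xi> \<epsilon>) (\<rho> \<epsilon> n) i"
  show "((\<lambda>\<epsilon>. heat_bdf2 dt dx (\<rho> \<epsilon> (n - 1)) (\<rho> \<epsilon> n) (\<sigma> \<epsilon> (n + 1)) i) \<longlongrightarrow> 0) (at_right 0)"
    unfolding heat_bdf2_def
  proof (rule diffusive_limit[OF dt, where F = ?F])
    show "\<forall>\<^sub>F \<epsilon> in at_right 0. \<bar>?F \<epsilon>\<bar> \<le> 4 * (4 * C / dx)"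
      using C eventually_at_right_less[of 0]
    proof eventually_elim
      case (elim \<epsilon>)
      have xi: "0 \<le> ?\<xi> \<epsilon>" "?\<xi> \<epsilon> \<le> 1"
        using shift[OF elim(2)] unfolding is_shift_def by linarith+
      have four: "\<bar>a - b - c + e\<bar> \<le> 4 * B"
        if "\<bar>a\<bar> \<le> B" "\<bar>b\<bar> \<le> B" "\<bar>c\<bar> \<le> B" "\<bar>e\<bar> \<le> B" for a b c e B :: real
        using that by linarith
      show ?case
        by (intro four flux_bounds[OF xi dx]) (use elim in blast)+
    qed
    show "\<forall>\<^sub>F \<epsilon> in at_right 0. \<bar>lap dx (\<sigma> \<epsilon> (n + 1)) i\<bar> \<le> 4 * C / dx^2"
      using C by eventually_elim (rule lap_bound[OF _ dx], use n in simp)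
  qed (use step in blast)
  show "((\<lambda>\<epsilon>. p \<epsilon> (n + 1) i - \<sigma> \<epsilon> (n + 1) i) \<longlongrightarrow> 0) (at_right 0)"
  proof (rule relaxation_limit)
    let ?T = "\<lambda>\<epsilon>. p \<epsilon> (n + 1) (i - 2) - 4 * p \<epsilon> (n + 1) (i - 1) + 3 * p \<epsilon> (n + 1) i"
    show "(p \<epsilon> (n - 1) i - 4 * p \<epsilon> n i + 3 * p \<epsilon> (n + 1) i) / (2 * dt) + ?T \<epsilon> / (2 * dx) / \<epsilon>
        = (\<sigma> \<epsilon> (n + 1) i - p \<epsilon> (n + 1) i) / \<epsilon>^2" if "\<epsilon> > 0" for \<epsilon>
      using step[OF that] by (simp add: mult_ac)
    show "\<forall>\<^sub>F \<epsilon> in at_right 0.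
        \<bar>(p \<epsilon> (n - 1) i - 4 * p \<epsilon> n i + 3 * p \<epsilon> (n + 1) i) / (2 * dt)\<bar> \<le> 8 * C / (2 * dt)"
      using C by eventually_elim (intro abs_divide_le bdf, use dt in auto)
    show "\<forall>\<^sub>F \<epsilon> in at_right 0. \<bar>?T \<epsilon> / (2 * dx)\<bar> \<le> 8 * C / (2 * dx)"
      using C by eventually_elim (intro abs_divide_le bdf, use dx in auto)
  qed
  show "((\<lambda>\<epsilon>. q \<epsilon> (n + 1) i - \<sigma> \<epsilon> (n + 1) i) \<longlongrightarrow> 0) (at_right 0)"
  proof (rule relaxation_limit)
    let ?T = "\<lambda>\<epsilon>. q \<epsilon> (n + 1) (i + 2) - 4 * q \<epsilon> (n + 1) (i + 1) + 3 * q \<epsilon> (n + 1) i"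
    show "(q \<epsilon> (n - 1) i - 4 * q \<epsilon> n i + 3 * q \<epsilon> (n + 1) i) / (2 * dt) + ?T \<epsilon> / (2 * dx) / \<epsilon>
        = (\<sigma> \<epsilon> (n + 1) i - q \<epsilon> (n + 1) i) / \<epsilon>^2" if "\<epsilon> > 0" for \<epsilon>
    proof -
      have "?T \<epsilon> / (2 * dx) / \<epsilon> = - ((- 3 * q \<epsilon> (n + 1) i + 4 * q \<epsilon> (n + 1) (i + 1)
          - q \<epsilon> (n + 1) (i + 2)) / (2 * \<epsilon> * dx))"
        using that dx by (simp add: field_simps)
      then show ?thesis
        using step[OF that] by linarith
    qed
    show "\<forall>\<^sub>F \<epsilon> in at_right 0.
        \<bar>(q \<epsilon> (n - 1) i - 4 * q \<epsilon> n i + 3 * q \<epsilon> (n + 1) i) / (2 * dt)\<bar> \<le> 8 * C / (2 * dt)"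
      using C by eventually_elim (intro abs_divide_le bdf, use dt in auto)
    show "\<forall>\<^sub>F \<epsilon> in at_right 0. \<bar>?T \<epsilon> / (2 * dx)\<bar> \<le> 8 * C / (2 * dx)"
      using C by eventually_elim (intro abs_divide_le bdf, use dx in auto)
  qed
qed

lemma mean_limit:
  fixes p q \<rho> s :: "real \<Rightarrow> real"
  assumes "\<And>\<epsilon>. \<epsilon> > 0 \<Longrightarrow> \<rho> \<epsilon> = (p \<epsilon> + q \<epsilon>) / 2"
    and "((\<lambda>\<epsilon>. p \<epsilon> - s \<epsilon>) \<longlongrightarrow> 0) (at_right 0)"
    and "((\<lambda>\<epsilon>. q \<epsilon> - s \<epsilon>) \<longlongrightarrow> 0) (at_right 0)"
  shows "((\<lambda>\<epsilon>. \<rho> \<epsilon> - s \<epsilon>) \<longlongrightarrow> 0) (at_right 0)"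
proof (rule Lim_transform_eventually)
  show "((\<lambda>\<epsilon>. ((p \<epsilon> - s \<epsilon>) + (q \<epsilon> - s \<epsilon>)) / 2) \<longlongrightarrow> 0) (at_right 0)"
    using tendsto_divide[OF tendsto_add[OF assms(2,3)] tendsto_const[of 2]] by simp
  show "\<forall>\<^sub>F \<epsilon> in at_right 0. ((p \<epsilon> - s \<epsilon>) + (q \<epsilon> - s \<epsilon>)) / 2 = \<rho> \<epsilon> - s \<epsilon>"
    using eventually_at_right_less[of 0]
    by eventually_elim (simp add: assms(1) field_simps)
qed

text \<open>
  The smallness results compare two quantities that both vary with \<open>\<epsilon>\<close> and need not converge; once
  one of them converges along a sequence, so does the other.
\<close>

lemma limit_along_sequence:
  fixes f s :: "real \<Rightarrow> real"
  assumes "((\<lambda>\<epsilon>. f \<epsilon> - s \<epsilon>) \<longlongrightarrow> 0) (at_right 0)" and "filterlim e (at_right 0) sequentially"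
    and "(\<lambda>k. s (e k)) \<longlonglongrightarrow> l"
  shows "(\<lambda>k. f (e k)) \<longlonglongrightarrow> l"
  using tendsto_add[OF filterlim_compose[OF assms(1,2)] assms(3)] by simp

lemma lap_tendsto [tendsto_intros]:
  assumes "\<And>i. ((\<lambda>k. u k i) \<longlongrightarrow> s i) F"
  shows "((\<lambda>k. lap dx (u k) i) \<longlongrightarrow> lap dx s i) F"
  unfolding lap_def divide_inverse by (intro tendsto_intros assms)

lemma heat_euler_limit:
  fixes e :: "nat \<Rightarrow> real"
  assumes lim: "((\<lambda>\<epsilon>. heat_euler dt dx (u \<epsilon>) (w \<epsilon>) i) \<longlongrightarrow> 0) (at_right 0)"
    and e: "filterlim e (at_right 0) sequentially"
    and u: "\<And>i. (\<lambda>k. u (e k) i) \<longlonglongrightarrow> r i" and w: "\<And>i. (\<lambda>k. w (e k) i) \<longlonglongrightarrow> s i"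
  shows "heat_euler dt dx r s i = 0"
proof (rule LIMSEQ_unique)
  show "(\<lambda>k. heat_euler dt dx (u (e k)) (w (e k)) i) \<longlonglongrightarrow> heat_euler dt dx r s i"
    unfolding heat_euler_def divide_inverse by (intro tendsto_intros u w)
  show "(\<lambda>k. heat_euler dt dx (u (e k)) (w (e k)) i) \<longlonglongrightarrow> 0"
    by (rule filterlim_compose[OF lim e])
qed

lemma heat_bdf2_limit:
  fixes e :: "nat \<Rightarrow> real"
  assumes lim: "((\<lambda>\<epsilon>. heat_bdf2 dt dx (v \<epsilon>) (u \<epsilon>) (w \<epsilon>) i) \<longlongrightarrow> 0) (at_right 0)"
    and e: "filterlim e (at_right 0) sequentially"
    and v: "\<And>i. (\<lambda>k. v (e k) i) \<longlonglongrightarrow> r' i"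
    and u: "\<And>i. (\<lambda>k. u (e k) i) \<longlonglongrightarrow> r i" and w: "\<And>i. (\<lambda>k. w (e k) i) \<longlonglongrightarrow> s i"
  shows "heat_bdf2 dt dx r' r s i = 0"
proof (rule LIMSEQ_unique)
  show "(\<lambda>k. heat_bdf2 dt dx (v (e k)) (u (e k)) (w (e k)) i) \<longlonglongrightarrow> heat_bdf2 dt dx r' r s i"
    unfolding heat_bdf2_def divide_inverse by (intro tendsto_intros u v w)
  show "(\<lambda>k. heat_bdf2 dt dx (v (e k)) (u (e k)) (w (e k)) i) \<longlonglongrightarrow> 0"
    by (rule filterlim_compose[OF lim e])
qed

section \<open>Consistency with the heat equation\<close>

text \<open>
  The predicate \<open>C_k\<close> provides both partial derivatives at every stage. Taylor expansion in one
  variable only needs a chain of derivatives in that variable, continuous as a function of both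
  variables at its end so that the remainder can be bounded uniformly.
\<close>

lemma C_k_iterated_x:
  "C_k k \<phi> \<Longrightarrow> \<exists>d. d 0 = \<phi> \<and> continuous_on UNIV (\<lambda>(x, t). d k x t) \<and>
     (\<forall>j<k. \<forall>x t. ((\<lambda>y. d j y t) has_real_derivative d (Suc j) x t) (at x))"
proof (induction k arbitrary: \<phi>)
  case 0
  then show ?case by (intro exI[of _ "\<lambda>_. \<phi>"]) simp
next
  case (Suc k)
  from Suc.prems obtain \<phi>x where \<phi>x: "C_k k \<phi>x"
    "\<And>x t. ((\<lambda>y. \<phi> y t) has_real_derivative \<phi>x x t) (at x)"
    by auto
  from Suc.IH[OF \<phi>x(1)] obtain d where d: "d 0 = \<phi>x" "continuous_on UNIV (\<lambda>(x, t). d k x t)"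
    "\<And>j x t. j < k \<Longrightarrow> ((\<lambda>y. d j y t) has_real_derivative d (Suc j) x t) (at x)"
    by blast
  show ?case
    by (rule exI[of _ "case_nat \<phi> d"]) (use \<phi>x d in \<open>auto split: nat.splits\<close>)
qed

lemma C_k_iterated_t:
  "C_k k \<phi> \<Longrightarrow> \<exists>d. d 0 = \<phi> \<and> continuous_on UNIV (\<lambda>(x, t). d k x t) \<and>
     (\<forall>j<k. \<forall>x t. ((\<lambda>s. d j x s) has_real_derivative d (Suc j) x t) (at t))"
proof (induction k arbitrary: \<phi>)
  case 0
  then show ?case by (intro exI[of _ "\<lambda>_. \<phi>"]) simp
next
  case (Suc k)
  from Suc.prems obtain \<phi>t where \<phi>t: "C_k k \<phi>t"
    "\<And>x t. ((\<lambda>s. \<phi> x s) has_real_derivative \<phi>t x t) (at t)"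
    by auto
  from Suc.IH[OF \<phi>t(1)] obtain d where d: "d 0 = \<phi>t" "continuous_on UNIV (\<lambda>(x, t). d k x t)"
    "\<And>j x t. j < k \<Longrightarrow> ((\<lambda>s. d j x s) has_real_derivative d (Suc j) x t) (at t)"
    by blast
  show ?case
    by (rule exI[of _ "case_nat \<phi> d"]) (use \<phi>t d in \<open>auto split: nat.splits\<close>)
qed

lemma continuous_bounded_on_square:
  fixes g :: "real \<Rightarrow> real \<Rightarrow> real"
  assumes "continuous_on UNIV (\<lambda>(x, t). g x t)"
  obtains M where "M \<ge> 0" "\<And>x t. \<bar>x\<bar> \<le> R \<Longrightarrow> \<bar>t\<bar> \<le> R \<Longrightarrow> \<bar>g x t\<bar> \<le> M"
proof -
  have "compact ((\<lambda>(x, t). g x t) ` ({-R..R} \<times> {-R..R}))"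
    using assms by (intro compact_continuous_image compact_Times) (auto intro: continuous_on_subset)
  then obtain M where M: "\<And>y. y \<in> (\<lambda>(x, t). g x t) ` ({-R..R} \<times> {-R..R}) \<Longrightarrow> norm y \<le> M"
    using compact_imp_bounded bounded_iff by metis
  have "\<bar>g x t\<bar> \<le> max 0 M" if "\<bar>x\<bar> \<le> R" "\<bar>t\<bar> \<le> R" for x t
  proof -
    have "norm (g x t) \<le> M"
      by (rule M) (use that in \<open>auto intro!: image_eqI[of _ _ "(x, t)"]\<close>)
    then show ?thesis by simp
  qed
  then show ?thesis
    using that[of "max 0 M"] by simp
qed

lemma Taylor_remainder_bound:
  fixes d :: "nat \<Rightarrow> real \<Rightarrow> real"
  assumes deriv: "\<And>j y. j < n \<Longrightarrow> (d j has_real_derivative d (Suc j) y) (at y)"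
    and M: "\<And>y. \<bar>y\<bar> \<le> r \<Longrightarrow> \<bar>d n y\<bar> \<le> M" and "n > 0"
    and c: "\<bar>c\<bar> \<le> r" and ch: "\<bar>c + h\<bar> \<le> r" "h \<noteq> 0"
  shows "\<bar>d 0 (c + h) - (\<Sum>j<n. d j c / fact j * h ^ j)\<bar> \<le> M / fact n * \<bar>h\<bar> ^ n"
proof -
  have "\<exists>t. (if c + h < c then c + h < t \<and> t < c else c < t \<and> t < c + h) \<and>
      d 0 (c + h) = (\<Sum>j<n. d j c / fact j * (c + h - c) ^ j) + d n t / fact n * (c + h - c) ^ n"
    by (rule Taylor[where a = "- r" and b = r]) (use assms in auto)
  then obtain t where t: "if c + h < c then c + h < t \<and> t < c else c < t \<and> t < c + h"
    and eq: "d 0 (c + h) = (\<Sum>j<n. d j c / fact j * h ^ j) + d n t / fact n * h ^ n"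
    by auto
  have "\<bar>t\<bar> \<le> r"
    using t c ch by (auto split: if_splits)
  then have "\<bar>d n t / fact n * h ^ n\<bar> \<le> M / fact n * \<bar>h\<bar> ^ n"
    using M by (simp add: abs_mult power_abs divide_right_mono mult_right_mono)
  then show ?thesis
    using eq by simp
qed

text \<open>
  In this and the two following lemmas \<open>d j\<close> is the \<open>j\<close>-th derivative of \<open>d 0\<close>. Each stencil
  reproduces the derivative exactly on the Taylor polynomials used, so that only the remainders
  are left.
\<close>

lemma backward_euler_error:
  fixes d :: "nat \<Rightarrow> real \<Rightarrow> real"
  assumes deriv: "\<And>j y. j < 2 \<Longrightarrow> (d j has_real_derivative d (Suc j) y) (at y)"
    and M: "\<And>y. \<bar>y\<bar> \<le> r \<Longrightarrow> \<bar>d 2 y\<bar> \<le> M"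
    and "\<bar>c\<bar> \<le> r" "\<bar>c - h\<bar> \<le> r" "h > 0"
  shows "\<bar>(d 0 c - d 0 (c - h)) / h - d 1 c\<bar> \<le> M / 2 * h"
proof -
  have *: "\<bar>d 0 (c - h) - (d 0 c - d 1 c * h)\<bar> \<le> M / 2 * h^2"
    using Taylor_remainder_bound[of 2 d r M c "- h"] assms by (simp add: numeral_2_eq_2)
  have "(d 0 c - d 0 (c - h)) / h - d 1 c = - ((d 0 (c - h) - (d 0 c - d 1 c * h)) / h)"
    using \<open>h > 0\<close> by (simp add: field_simps)
  also have "\<bar>\<dots>\<bar> \<le> (M / 2 * h^2) / h"
    using * \<open>h > 0\<close> unfolding abs_minus_cancel
    by (intro abs_divide_le)
  finally show ?thesis
    using \<open>h > 0\<close> by (simp add: power2_eq_square)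
qed

lemma bdf2_error:
  fixes d :: "nat \<Rightarrow> real \<Rightarrow> real"
  assumes deriv: "\<And>j y. j < 3 \<Longrightarrow> (d j has_real_derivative d (Suc j) y) (at y)"
    and M: "\<And>y. \<bar>y\<bar> \<le> r \<Longrightarrow> \<bar>d 3 y\<bar> \<le> M"
    and "\<bar>c\<bar> \<le> r" "\<bar>c - 2 * h\<bar> \<le> r" "h > 0"
  shows "\<bar>(d 0 (c - 2 * h) - 4 * d 0 (c - h) + 3 * d 0 c) / (2 * h) - d 1 c\<bar> \<le> M * h^2"
proof -
  \<comment> \<open>Taylor polynomials at \<open>c - h\<close> and \<open>c - 2 * h\<close>; the weights -4 and 1 cancel \<open>d 2 c\<close>.\<close>
  let ?P = "d 0 c - d 1 c * h + d 2 c / 2 * h^2"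
  let ?Q = "d 0 c - 2 * d 1 c * h + 2 * d 2 c * h^2"
  have "\<bar>c - h\<bar> \<le> r" using assms by linarith
  then have P: "\<bar>d 0 (c - h) - ?P\<bar> \<le> M / 6 * h^3"
    using Taylor_remainder_bound[of 3 d r M c "- h"] assms
    by (simp add: eval_nat_numeral lessThan_Suc algebra_simps)
  have Q: "\<bar>d 0 (c - 2 * h) - ?Q\<bar> \<le> 8 * M / 6 * h^3"
    using Taylor_remainder_bound[of 3 d r M c "- 2 * h"] assms
    by (simp add: eval_nat_numeral lessThan_Suc algebra_simps)
  have "(d 0 (c - 2 * h) - 4 * d 0 (c - h) + 3 * d 0 c) / (2 * h) - d 1 c
      = ((d 0 (c - 2 * h) - ?Q) - 4 * (d 0 (c - h) - ?P)) / (2 * h)"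
    using \<open>h > 0\<close> by (simp add: field_simps power2_eq_square)
  also have "\<bar>\<dots>\<bar> \<le> (2 * M * h^3) / (2 * h)"
  proof (rule abs_divide_le)
    have *: "\<bar>a - 4 * b\<bar> \<le> 2 * K" if "\<bar>a\<bar> \<le> 8 * K / 6" "\<bar>b\<bar> \<le> K / 6" for a b K :: real
      using that by linarith
    show "\<bar>(d 0 (c - 2 * h) - ?Q) - 4 * (d 0 (c - h) - ?P)\<bar> \<le> 2 * M * h^3"
      unfolding mult.assoc[of 2 M] by (rule *) (use P Q in simp_all)
  qed (use \<open>h > 0\<close> in simp)
  finally show ?thesis
    using \<open>h > 0\<close> by (simp add: power2_eq_square power3_eq_cube)
qed

lemma central_difference_error:
  fixes d :: "nat \<Rightarrow> real \<Rightarrow> real"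
  assumes deriv: "\<And>j y. j < 4 \<Longrightarrow> (d j has_real_derivative d (Suc j) y) (at y)"
    and M: "\<And>y. \<bar>y\<bar> \<le> r \<Longrightarrow> \<bar>d 4 y\<bar> \<le> M"
    and "\<bar>c - h\<bar> \<le> r" "\<bar>c + h\<bar> \<le> r" "h > 0"
  shows "\<bar>(d 0 (c - h) - 2 * d 0 c + d 0 (c + h)) / h^2 - d 2 c\<bar> \<le> M / 12 * h^2"
proof -
  \<comment> \<open>The odd terms cancel by symmetry, so the error is of order 2.\<close>
  let ?P = "d 0 c - d 1 c * h + d 2 c / 2 * h^2 - d 3 c / 6 * h^3"
  let ?Q = "d 0 c + d 1 c * h + d 2 c / 2 * h^2 + d 3 c / 6 * h^3"
  have "\<bar>c\<bar> \<le> r" using assms by linarith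
  then have P: "\<bar>d 0 (c - h) - ?P\<bar> \<le> M / 24 * h^4"
    using Taylor_remainder_bound[of 4 d r M c "- h"] assms
    by (simp add: eval_nat_numeral lessThan_Suc algebra_simps)
  have Q: "\<bar>d 0 (c + h) - ?Q\<bar> \<le> M / 24 * h^4"
    using \<open>\<bar>c\<bar> \<le> r\<close> Taylor_remainder_bound[of 4 d r M c h] assms
    by (simp add: eval_nat_numeral lessThan_Suc algebra_simps)
  have "(d 0 (c - h) - 2 * d 0 c + d 0 (c + h)) / h^2 - d 2 c
      = ((d 0 (c - h) - ?P) + (d 0 (c + h) - ?Q)) / h^2"
    using \<open>h > 0\<close> by (simp add: field_simps)
  also have "\<bar>\<dots>\<bar> \<le> (M / 12 * h^4) / h^2"
  proof (rule abs_divide_le)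
    show "\<bar>(d 0 (c - h) - ?P) + (d 0 (c + h) - ?Q)\<bar> \<le> M / 12 * h^4"
      using abs_triangle_ineq[of "d 0 (c - h) - ?P" "d 0 (c + h) - ?Q"] P Q by linarith
  qed (use \<open>h > 0\<close> in simp)
  also have "\<dots> = M / 12 * h^2"
    using \<open>h > 0\<close> by (simp add: field_simps eval_nat_numeral)
  finally show ?thesis .
qed

lemma lap_consistency:
  assumes "smooth_fun \<phi>"
  obtains M where "M \<ge> 0"
    "\<And>dt dx x t. 0 < dx \<Longrightarrow> dx < 1 \<Longrightarrow> \<bar>x\<bar> \<le> R \<Longrightarrow> \<bar>t\<bar> \<le> R \<Longrightarrow>
       \<bar>lap dx (sample \<phi> x t dt dx 0) 0 - deriv (deriv (\<lambda>y. \<phi> y t)) x\<bar> \<le> M * dx^2"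
proof -
  have "C_k 4 \<phi>" using assms unfolding smooth_fun_def by blast
  from C_k_iterated_x[OF this] obtain d where d0: "d 0 = \<phi>"
    and cont: "continuous_on UNIV (\<lambda>(x, t). d 4 x t)"
    and d: "\<And>j x t. j < 4 \<Longrightarrow> ((\<lambda>y. d j y t) has_real_derivative d (Suc j) x t) (at x)"
    by blast
  obtain M where M: "M \<ge> 0" "\<And>x t. \<bar>x\<bar> \<le> R + 1 \<Longrightarrow> \<bar>t\<bar> \<le> R + 1 \<Longrightarrow> \<bar>d 4 x t\<bar> \<le> M"
    using continuous_bounded_on_square[OF cont] by metis
  have dd: "deriv (deriv (\<lambda>y. \<phi> y t)) x = d 2 x t" for x t
  proof -
    have "deriv (\<lambda>y. \<phi> y t) = (\<lambda>y. d 1 y t)"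
      using d[of 0] d0 by (intro ext DERIV_imp_deriv) simp
    then show ?thesis
      using d[of 1] by (simp add: DERIV_imp_deriv numeral_2_eq_2)
  qed
  show ?thesis
  proof (rule that)
    show "M / 12 \<ge> 0" using M by simp
    fix dt dx x t :: real
    assume a: "0 < dx" "dx < 1" "\<bar>x\<bar> \<le> R" "\<bar>t\<bar> \<le> R"
    have "\<bar>(d 0 (x - dx) t - 2 * d 0 x t + d 0 (x + dx) t) / dx^2 - d 2 x t\<bar> \<le> M / 12 * dx^2"
      by (rule central_difference_error[where d = "\<lambda>j y. d j y t" and r = "R + 1"])
        (use a d M in auto)
    then show "\<bar>lap dx (sample \<phi> x t dt dx 0) 0 - deriv (deriv (\<lambda>y. \<phi> y t)) x\<bar> \<le> M / 12 * dx^2"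
      by (simp add: dd lap_def sample_def d0)
  qed
qed

lemma heat_euler_consistent: "heat_consistent (\<lambda>dt dx u. heat_euler dt dx (u (-1)) (u 0) 0)"
  unfolding heat_consistent_def
proof (intro allI impI)
  fix \<phi> :: "real \<Rightarrow> real \<Rightarrow> real" and R \<eta> :: real
  assume smooth: "smooth_fun \<phi>" and \<eta>: "\<eta> > 0"
  obtain L where L: "L \<ge> 0"
    "\<And>dt dx x t. 0 < dx \<Longrightarrow> dx < 1 \<Longrightarrow> \<bar>x\<bar> \<le> R \<Longrightarrow> \<bar>t\<bar> \<le> R \<Longrightarrow>
       \<bar>lap dx (sample \<phi> x t dt dx 0) 0 - deriv (deriv (\<lambda>y. \<phi> y t)) x\<bar> \<le> L * dx^2"
    using lap_consistency[OF smooth] by blast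
  have "C_k 2 \<phi>" using smooth unfolding smooth_fun_def by blast
  from C_k_iterated_t[OF this] obtain d where d0: "d 0 = \<phi>"
    and cont: "continuous_on UNIV (\<lambda>(x, t). d 2 x t)"
    and d: "\<And>j x t. j < 2 \<Longrightarrow> ((\<lambda>s. d j x s) has_real_derivative d (Suc j) x t) (at t)"
    by blast
  obtain M where M: "M \<ge> 0" "\<And>x t. \<bar>x\<bar> \<le> R + 1 \<Longrightarrow> \<bar>t\<bar> \<le> R + 1 \<Longrightarrow> \<bar>d 2 x t\<bar> \<le> M"
    using continuous_bounded_on_square[OF cont] by metis
  have dd: "deriv (\<lambda>s. \<phi> x s) t = d 1 x t" for x t
    using d[of 0] d0 by (intro DERIV_imp_deriv) simp
  \<comment> \<open>The summand 1 makes \<open>K\<close> positive and the final estimate strict.\<close>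
  define K where "K = M / 2 + L + 1"
  define \<delta> where "\<delta> = min 1 (\<eta> / K)"
  have K: "K > 0" using M(1) L(1) by (simp add: K_def)
  have "\<bar>heat_euler dt dx (sample \<phi> x t dt dx (-1)) (sample \<phi> x t dt dx 0) 0 - heat_op \<phi> x t\<bar> < \<eta>"
    if a: "dt \<in> {0<..<\<delta>}" "dx \<in> {0<..<\<delta>}" "x \<in> {-R..R}" "t \<in> {-R..R}" for dt dx x t
  proof -
    have small: "0 < dt" "dt < 1" "0 < dx" "dx < 1" "dt < \<eta> / K" "dx < \<eta> / K"
      using a by (auto simp: \<delta>_def)
    have bnds: "\<bar>x\<bar> \<le> R" "\<bar>t\<bar> \<le> R" using a by auto
    have time: "\<bar>(d 0 x t - d 0 x (t - dt)) / dt - d 1 x t\<bar> \<le> M / 2 * dt"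
      by (rule backward_euler_error[where r = "R + 1"]) (use small bnds d M in auto)
    have "heat_euler dt dx (sample \<phi> x t dt dx (-1)) (sample \<phi> x t dt dx 0) 0 - heat_op \<phi> x t
        = ((d 0 x t - d 0 x (t - dt)) / dt - d 1 x t)
          - (lap dx (sample \<phi> x t dt dx 0) 0 - deriv (deriv (\<lambda>y. \<phi> y t)) x)"
      by (simp add: heat_euler_def heat_op_def dd d0) (simp add: sample_def)
    also have "\<bar>\<dots>\<bar> \<le> M / 2 * dt + L * dx^2"
      using time L(2)[of dx x t dt] small bnds by linarith
    also have "\<dots> \<le> M / 2 * max dt dx + L * max dt dx"
    proof (intro add_mono mult_left_mono)
      have "dx^2 \<le> dx" using small by (simp add: power2_eq_square mult_le_cancel_right1)
      then show "dx^2 \<le> max dt dx" by simp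
    qed (use M L in auto)
    also have "\<dots> < K * max dt dx"
      using small by (simp add: K_def algebra_simps)
    also have "\<dots> < \<eta>"
      using small K by (simp add: field_simps max_def)
    finally show ?thesis .
  qed
  moreover have "\<delta> > 0" using \<eta> K by (simp add: \<delta>_def)
  ultimately show "\<exists>\<delta>>0. \<forall>dt\<in>{0<..<\<delta>}. \<forall>dx\<in>{0<..<\<delta>}. \<forall>x\<in>{-R..R}. \<forall>t\<in>{-R..R}.
      \<bar>heat_euler dt dx (sample \<phi> x t dt dx (-1)) (sample \<phi> x t dt dx 0) 0 - heat_op \<phi> x t\<bar> < \<eta>"
    by blast
qed

lemma heat_bdf2_consistent:
  "heat_consistent_order 2 (\<lambda>dt dx u. heat_bdf2 dt dx (u (-2)) (u (-1)) (u 0) 0)"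
  unfolding heat_consistent_order_def
proof (intro allI impI)
  fix \<phi> :: "real \<Rightarrow> real \<Rightarrow> real" and R :: real
  assume smooth: "smooth_fun \<phi>"
  obtain L where L: "L \<ge> 0"
    "\<And>dt dx x t. 0 < dx \<Longrightarrow> dx < 1 \<Longrightarrow> \<bar>x\<bar> \<le> R \<Longrightarrow> \<bar>t\<bar> \<le> R \<Longrightarrow>
       \<bar>lap dx (sample \<phi> x t dt dx 0) 0 - deriv (deriv (\<lambda>y. \<phi> y t)) x\<bar> \<le> L * dx^2"
    using lap_consistency[OF smooth] by blast
  have "C_k 3 \<phi>" using smooth unfolding smooth_fun_def by blast
  from C_k_iterated_t[OF this] obtain d where d0: "d 0 = \<phi>"
    and cont: "continuous_on UNIV (\<lambda>(x, t). d 3 x t)"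
    and d: "\<And>j x t. j < 3 \<Longrightarrow> ((\<lambda>s. d j x s) has_real_derivative d (Suc j) x t) (at t)"
    by blast
  \<comment> \<open>The stencil reaches back to \<open>t - 2 * dt\<close> with \<open>dt < 1\<close>.\<close>
  obtain M where M: "M \<ge> 0" "\<And>x t. \<bar>x\<bar> \<le> R + 2 \<Longrightarrow> \<bar>t\<bar> \<le> R + 2 \<Longrightarrow> \<bar>d 3 x t\<bar> \<le> M"
    using continuous_bounded_on_square[OF cont] by metis
  have dd: "deriv (\<lambda>s. \<phi> x s) t = d 1 x t" for x t
    using d[of 0] d0 by (intro DERIV_imp_deriv) simp
  have "\<bar>heat_bdf2 dt dx (sample \<phi> x t dt dx (-2)) (sample \<phi> x t dt dx (-1))
        (sample \<phi> x t dt dx 0) 0 - heat_op \<phi> x t\<bar> \<le> (M + L) * (dt^2 + dx^2)"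
    if a: "dt \<in> {0<..<1}" "dx \<in> {0<..<1}" "x \<in> {-R..R}" "t \<in> {-R..R}" for dt dx x t
  proof -
    have small: "0 < dt" "dt < 1" "0 < dx" "dx < 1" using a by auto
    have bnds: "\<bar>x\<bar> \<le> R" "\<bar>t\<bar> \<le> R" using a by auto
    have time: "\<bar>(d 0 x (t - 2 * dt) - 4 * d 0 x (t - dt) + 3 * d 0 x t) / (2 * dt) - d 1 x t\<bar>
        \<le> M * dt^2"
      by (rule bdf2_error[where r = "R + 2"]) (use small bnds d M in auto)
    have "heat_bdf2 dt dx (sample \<phi> x t dt dx (-2)) (sample \<phi> x t dt dx (-1))
          (sample \<phi> x t dt dx 0) 0 - heat_op \<phi> x t
        = ((d 0 x (t - 2 * dt) - 4 * d 0 x (t - dt) + 3 * d 0 x t) / (2 * dt) - d 1 x t)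
          - (lap dx (sample \<phi> x t dt dx 0) 0 - deriv (deriv (\<lambda>y. \<phi> y t)) x)"
      by (simp add: heat_bdf2_def heat_op_def dd d0) (simp add: sample_def)
    also have "\<bar>\<dots>\<bar> \<le> M * dt^2 + L * dx^2"
      using time L(2)[of dx x t dt] small bnds by linarith
    also have "\<dots> \<le> (M + L) * dt^2 + (M + L) * dx^2"
      using M(1) L(1) by (intro add_mono mult_right_mono) auto
    finally show ?thesis by (simp add: distrib_left)
  qed
  then show "\<exists>C. \<exists>\<delta>>0. \<forall>dt\<in>{0<..<\<delta>}. \<forall>dx\<in>{0<..<\<delta>}. \<forall>x\<in>{-R..R}. \<forall>t\<in>{-R..R}.
      \<bar>heat_bdf2 dt dx (sample \<phi> x t dt dx (-2)) (sample \<phi> x t dt dx (-1))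
        (sample \<phi> x t dt dx 0) 0 - heat_op \<phi> x t\<bar> \<le> C * (dt^2 + dx^2)"
    by (intro exI[of _ "M + L"] exI[of _ 1]) auto
qed

theorem mainTheorem1:
  fixes dt dx :: real and N :: nat and m :: "real \<Rightarrow> int"
  assumes "dt > 0" and "dx > 0" and "N > 0"
    and "\<And>\<epsilon>. \<epsilon> > 0 \<Longrightarrow> is_shift dt dx \<epsilon> (m \<epsilon>)"
  shows
    "(\<forall>\<sigma> p q \<rho> :: real \<Rightarrow> grid_function.
        (\<forall>\<epsilon>>0. first_order_scheme dt dx N \<epsilon> (m \<epsilon>) (\<sigma> \<epsilon>) (p \<epsilon>) (q \<epsilon>) (\<rho> \<epsilon>)) \<longrightarrow>
        bounded_solutions 1 \<sigma> p q \<rho> \<longrightarrow>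
        (\<forall>n i.
          ((\<lambda>\<epsilon>. heat_euler dt dx (\<rho> \<epsilon> n) (\<sigma> \<epsilon> (n + 1)) i) \<longlongrightarrow> 0) (at_right 0) \<and>
          ((\<lambda>\<epsilon>. p \<epsilon> (n + 1) i - \<sigma> \<epsilon> (n + 1) i) \<longlongrightarrow> 0) (at_right 0) \<and>
          ((\<lambda>\<epsilon>. q \<epsilon> (n + 1) i - \<sigma> \<epsilon> (n + 1) i) \<longlongrightarrow> 0) (at_right 0) \<and>
          ((\<lambda>\<epsilon>. \<rho> \<epsilon> (n + 1) i - \<sigma> \<epsilon> (n + 1) i) \<longlongrightarrow> 0) (at_right 0)) \<and>
        (\<forall>n (e :: nat \<Rightarrow> real) r s.
          filterlim e (at_right 0) sequentially \<longrightarrow>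
          (\<forall>i. (\<lambda>k. \<rho> (e k) n i) \<longlonglongrightarrow> r i) \<longrightarrow>
          (\<forall>i. (\<lambda>k. \<sigma> (e k) (n + 1) i) \<longlonglongrightarrow> s i) \<longrightarrow>
          (\<forall>i. (\<lambda>k. p (e k) (n + 1) i) \<longlonglongrightarrow> s i \<and>
               (\<lambda>k. q (e k) (n + 1) i) \<longlonglongrightarrow> s i \<and>
               (\<lambda>k. \<rho> (e k) (n + 1) i) \<longlonglongrightarrow> s i \<and>
               heat_euler dt dx r s i = 0)))
     \<and> heat_consistent (\<lambda>dt dx u. heat_euler dt dx (u (-1)) (u 0) 0)
     \<and> (\<forall>\<sigma> p q \<rho> :: real \<Rightarrow> grid_function.
        (\<forall>\<epsilon>>0. second_order_scheme dt dx N \<epsilon> (m \<epsilon>) (\<sigma> \<epsilon>) (p \<epsilon>) (q \<epsilon>) (\<rho> \<epsilon>)) \<longrightarrow>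
        bounded_solutions 2 \<sigma> p q \<rho> \<longrightarrow>
        (\<forall>n\<ge>1. \<forall>i.
          ((\<lambda>\<epsilon>. heat_bdf2 dt dx (\<rho> \<epsilon> (n - 1)) (\<rho> \<epsilon> n) (\<sigma> \<epsilon> (n + 1)) i) \<longlongrightarrow> 0) (at_right 0) \<and>
          ((\<lambda>\<epsilon>. p \<epsilon> (n + 1) i - \<sigma> \<epsilon> (n + 1) i) \<longlongrightarrow> 0) (at_right 0) \<and>
          ((\<lambda>\<epsilon>. q \<epsilon> (n + 1) i - \<sigma> \<epsilon> (n + 1) i) \<longlongrightarrow> 0) (at_right 0) \<and>
          ((\<lambda>\<epsilon>. \<rho> \<epsilon> (n + 1) i - \<sigma> \<epsilon> (n + 1) i) \<longlongrightarrow> 0) (at_right 0)) \<and>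
        (\<forall>n\<ge>1. \<forall>(e :: nat \<Rightarrow> real) r' r s.
          filterlim e (at_right 0) sequentially \<longrightarrow>
          (\<forall>i. (\<lambda>k. \<rho> (e k) (n - 1) i) \<longlonglongrightarrow> r' i) \<longrightarrow>
          (\<forall>i. (\<lambda>k. \<rho> (e k) n i) \<longlonglongrightarrow> r i) \<longrightarrow>
          (\<forall>i. (\<lambda>k. \<sigma> (e k) (n + 1) i) \<longlonglongrightarrow> s i) \<longrightarrow>
          (\<forall>i. (\<lambda>k. p (e k) (n + 1) i) \<longlonglongrightarrow> s i \<and>
               (\<lambda>k. q (e k) (n + 1) i) \<longlonglongrightarrow> s i \<and>
               (\<lambda>k. \<rho> (e k) (n + 1) i) \<longlonglongrightarrow> s i \<and>
               heat_bdf2 dt dx r' r s i = 0)))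
     \<and> heat_consistent_order 2
         (\<lambda>dt dx u. heat_bdf2 dt dx (u (-2)) (u (-1)) (u 0) 0)"
proof (intro conjI heat_euler_consistent heat_bdf2_consistent, goal_cases)
  case 1
  show ?case
  proof (intro allI impI, goal_cases)
    case (1 \<sigma> p q \<rho>)
    then have scheme: "\<And>\<epsilon>. \<epsilon> > 0 \<Longrightarrow>
        first_order_scheme dt dx N \<epsilon> (m \<epsilon>) (\<sigma> \<epsilon>) (p \<epsilon>) (q \<epsilon>) (\<rho> \<epsilon>)" by blast
    note ap = first_order_ap[OF assms(1,2) scheme 1(2)]
    have mean: "((\<lambda>\<epsilon>. \<rho> \<epsilon> (n + 1) i - \<sigma> \<epsilon> (n + 1) i) \<longlongrightarrow> 0) (at_right 0)" for n i
      by (rule mean_limit[OF _ ap(2,3)])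
        (use scheme in \<open>auto simp: first_order_scheme_def Let_def\<close>)
    show ?case
      by (intro conjI allI impI ap mean limit_along_sequence[OF ap(2)]
          limit_along_sequence[OF ap(3)] limit_along_sequence[OF mean] heat_euler_limit[OF ap(1)])
        blast+
  qed
next
  case 2
  show ?case
  proof (intro allI impI, goal_cases)
    case (1 \<sigma> p q \<rho>)
    then have scheme: "\<And>\<epsilon>. \<epsilon> > 0 \<Longrightarrow>
        second_order_scheme dt dx N \<epsilon> (m \<epsilon>) (\<sigma> \<epsilon>) (p \<epsilon>) (q \<epsilon>) (\<rho> \<epsilon>)" by blast
    note ap = second_order_ap[OF assms(1,2,4) scheme 1(2)]
    have mean: "((\<lambda>\<epsilon>. \<rho> \<epsilon> (n + 1) i - \<sigma> \<epsilon> (n + 1) i) \<longlongrightarrow> 0) (at_right 0)" if "n \<ge> 1" for n i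
      by (rule mean_limit[OF _ ap(2,3)])
        (use scheme that in \<open>auto simp: second_order_scheme_def Let_def\<close>)
    show ?case
      by (intro conjI allI impI ap mean limit_along_sequence[OF ap(2)]
          limit_along_sequence[OF ap(3)] limit_along_sequence[OF mean] heat_bdf2_limit[OF ap(1)])
        blast+
  qed
qed

end
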